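(* Let $G$ be a finite graph with positive Bakry-\'Emery curvature at every vertex, i.e. $G$ satisfies $CD(K,\infty)$ for some $K>0$. Then its fundamental group $\pi_1(G)$ is finite.
   Context: Graphs are simple and undirected, $G=(V,E)$; $x\sim y$ means $\{x,y\}\in E$. Curvature. For $f:V\to\mathbb R$ put $\Delta f(x)=\sum_{y\sim x}(f(y)-f(x))$, and for $f,g:V\to\mathbb R$ put $\Gamma(f,g)=\frac12(\Delta(fg)-f\Delta g-g\Delta f)$, $\Gamma_2(f,g)=\frac12(\Delta\Gamma(f,g)-\Gamma(f,\Delta g)-\Gamma(g,\Delta f))$, $\Gamma(f)=\Gamma(f,f)$, $\Gamma_2(f)=\Gamma_2(f,f)$. $G$ satisfies $CD(K,n)$ ($K\in\mathbb R$, $n\in(0,\infty]$) if $\Gamma_2(f)\ge\frac1n(\Delta f)^2+K\,\Gamma(f)$ holds at every vertex for all $f:V\to\mathbb R$; for $n=\infty$ the term $\frac1n(\Delta f)^2$ is $0$. Fundamental group. Fix a base vertex $v_*$. A based loop is a map $\phi:\{0,\dots,n\}\to V$ (for some $n\ge0$) with $\phi(0)=\phi(n)=v_*$ and, for each $i$, $\phi(i)=\phi(i+1)$ or $\phi(i)\sim\phi(i+1)$; its word is the sequence $\phi(0),\dots,\phi(n)$. Two based loops are equivalent (C-homotopic) if the word of one can be obtained from the word of the other by a finite sequence of the following transformations and their inverses (dots denote unchanged parts of the word): 1. $\dots abc\dots\mapsto\dots ac\dots$ where $(a,b,c)$ are the vertices of a triangle (circuit of length 3) in $G$; 2. $\dots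 abc\dots\mapsto\dots adc\dots$ where $(a,b,c,d)$ is a square (circuit of length 4) in $G$; 3. $\dots abcd\dots\mapsto\dots ad\dots$ where $(a,b,c,d)$ is a square in $G$; 4. $\dots aba\dots\mapsto\dots a\dots$ if $a\sim b$; 5. $\dots aa\dots\mapsto\dots a\dots$. $\pi_1(G)$ is the group of equivalence classes of based loops under concatenation. (Squares need not be induced.) *)

theory Defs
  imports "HOL-Analysis.Analysis" "HOL-Algebra.Group"
begin

locale simple_graph =
  fixes V :: "'a set" and E :: "'a set set"
  assumes edges: "e \<in> E \<Longrightarrow> e \<subseteq> V \<and> card e = 2"

definition adj :: "'a set set \<Rightarrow> 'a \<Rightarrow> 'a \<Rightarrow> bool" where
  "adj E x y \<longleftrightarrow> {x, y} \<in> E"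


section \<open>Bakry-Emery curvature\<close>

text \<open>
  Functions on the vertex set are total functions on the ambient type; their values outside of
  the vertex set are irrelevant, because every vertex has all its neighbours in the vertex set.
  The sums below have their intended meaning on locally finite graphs.
\<close>

definition laplacian :: "'a set set \<Rightarrow> ('a \<Rightarrow> real) \<Rightarrow> 'a \<Rightarrow> real" where
  "laplacian E f x = (\<Sum>y | adj E x y. f y - f x)"

definition Gamma1 :: "'a set set \<Rightarrow> ('a \<Rightarrow> real) \<Rightarrow> ('a \<Rightarrow> real) \<Rightarrow> 'a \<Rightarrow> real" where
  "Gamma1 E f g x =
     (laplacian E (\<lambda>y. f y * g y) x - f x * laplacian E g x - g x * laplacian E f x) / 2"

definition Gamma2 :: "'a set set \<Rightarrow> ('a \<Rightarrow> real) \<Rightarrow> ('a \<Rightarrow> real) \<Rightarrow> 'a \<Rightarrow> real" where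
  "Gamma2 E f g x =
     (laplacian E (Gamma1 E f g) x - Gamma1 E f (laplacian E g) x - Gamma1 E g (laplacian E f) x) / 2"

text \<open>
  The dimension parameter ranges over \<open>0 < n \<le> \<infinity>\<close>; in the extended reals \<open>1 / \<infinity> = 0\<close>, so the
  dimension term vanishes for \<open>n = \<infinity>\<close>.
\<close>

definition CD :: "'a set \<Rightarrow> 'a set set \<Rightarrow> real \<Rightarrow> ereal \<Rightarrow> bool" where
  "CD V E K n \<longleftrightarrow>
     (\<forall>f. \<forall>x\<in>V. Gamma2 E f f x \<ge>
        real_of_ereal (1 / n) * (laplacian E f x)\<^sup>2 + K * Gamma1 E f f x)"

lemma CD_infinity_iff:
  "CD V E K \<infinity> \<longleftrightarrow> (\<forall>f. \<forall>x\<in>V. Gamma2 E f f x \<ge> K * Gamma1 E f f x)"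
  by (simp add: CD_def)


section \<open>The fundamental group\<close>

definition triangle :: "'a set set \<Rightarrow> 'a \<Rightarrow> 'a \<Rightarrow> 'a \<Rightarrow> bool" where
  "triangle E a b c \<longleftrightarrow> distinct [a, b, c] \<and> adj E a b \<and> adj E b c \<and> adj E c a"

definition square :: "'a set set \<Rightarrow> 'a \<Rightarrow> 'a \<Rightarrow> 'a \<Rightarrow> 'a \<Rightarrow> bool" where
  "square E a b c d \<longleftrightarrow>
     distinct [a, b, c, d] \<and> adj E a b \<and> adj E b c \<and> adj E c d \<and> adj E d a"

text \<open>A based loop \<open>\<phi> : {0..n} \<rightarrow> V\<close> is represented by its word \<open>[\<phi> 0, \<dots>, \<phi> n]\<close>.\<close>

definition based_loops :: "'a set \<Rightarrow> 'a set set \<Rightarrow> 'a \<Rightarrow> 'a list set" where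
  "based_loops V E v =
     {w. w \<noteq> [] \<and> set w \<subseteq> V \<and> hd w = v \<and> last w = v \<and> successively (\<lambda>x y. x = y \<or> adj E x y) w}"

inductive C_move :: "'a set set \<Rightarrow> 'a list \<Rightarrow> 'a list \<Rightarrow> bool" for E where
  "triangle E a b c \<Longrightarrow> C_move E (us @ [a, b, c] @ ws) (us @ [a, c] @ ws)"
| "square E a b c d \<Longrightarrow> C_move E (us @ [a, b, c] @ ws) (us @ [a, d, c] @ ws)"
| "square E a b c d \<Longrightarrow> C_move E (us @ [a, b, c, d] @ ws) (us @ [a, d] @ ws)"
| "adj E a b \<Longrightarrow> C_move E (us @ [a, b, a] @ ws) (us @ [a] @ ws)"
| "C_move E (us @ [a, a] @ ws) (us @ [a] @ ws)"

definition C_homotopy :: "'a set \<Rightarrow> 'a set set \<Rightarrow> 'a \<Rightarrow> ('a list \<times> 'a list) set" where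
  "C_homotopy V E v =
     {(p, q). p \<in> based_loops V E v \<and> q \<in> based_loops V E v \<and> equivclp (C_move E) p q}"

text \<open>
  The last letter of a based loop and the first letter of the next one are the same base vertex,
  which occurs only once in the word \<open>p @ tl q\<close> of the concatenation.
\<close>

definition fundamental_group :: "'a set \<Rightarrow> 'a set set \<Rightarrow> 'a \<Rightarrow> 'a list set monoid" where
  "fundamental_group V E v =
     \<lparr>carrier = based_loops V E v // C_homotopy V E v,
      mult = (\<lambda>A B. \<Union>p\<in>A. \<Union>q\<in>B. C_homotopy V E v `` {p @ tl q}),
      one = C_homotopy V E v `` {[v]}\<rparr>"

lemma equivclp_C_move_context:
  assumes "equivclp (C_move E) p q"
  shows "equivclp (C_move E) (xs @ p @ ys) (xs @ q @ ys)"
proof -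
  have ctx: "C_move E (xs @ p @ ys) (xs @ q @ ys)" if "C_move E p q" for p q
    using that
  proof cases
    case (1 a b c us ws)
    then show ?thesis using C_move.intros(1)[of E a b c "xs @ us" "ws @ ys"] by simp
  next
    case (2 a b c d us ws)
    then show ?thesis using C_move.intros(2)[of E a b c d "xs @ us" "ws @ ys"] by simp
  next
    case (3 a b c d us ws)
    then show ?thesis using C_move.intros(3)[of E a b c d "xs @ us" "ws @ ys"] by simp
  next
    case (4 a b us ws)
    then show ?thesis using C_move.intros(4)[of E a b "xs @ us" "ws @ ys"] by simp
  next
    case (5 us a ws)
    then show ?thesis using C_move.intros(5)[of E "xs @ us" a "ws @ ys"] by simp
  qed
  show ?thesis
    using assms
  proof (induction rule: equivclp_induct)
    case base
    show ?case by simp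
  next
    case (step y z)
    then have "equivclp (C_move E) (xs @ y @ ys) (xs @ z @ ys)"
      using ctx by (meson r_into_equivclp equivclp_sym)
    with step.IH show ?case by (rule equivclp_trans)
  qed
qed

lemma equivclp_C_move_backtrack:
  assumes "w \<noteq> []" "successively (\<lambda>x y. x = y \<or> adj E x y) w"
  shows "equivclp (C_move E) (butlast w @ rev w) [hd w]"
  using assms
proof (induction w)
  case Nil
  then show ?case by simp
next
  case (Cons a w)
  show ?case
  proof (cases w)
    case Nil
    then show ?thesis by simp
  next
    case (Cons b ws)
    have ab: "a = b \<or> adj E a b" and sw: "successively (\<lambda>x y. x = y \<or> adj E x y) w"
      using Cons.prems Cons by auto
    have "equivclp (C_move E) (butlast w @ rev w) [b]"
      using Cons.IH[OF _ sw] Cons by simp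
    from equivclp_C_move_context[OF this, of "[a]" "[a]"]
    have 1: "equivclp (C_move E) (butlast (a # w) @ rev (a # w)) [a, b, a]"
      using Cons by simp
    have 2: "equivclp (C_move E) [a, b, a] [a]"
    proof (cases "a = b")
      case True
      have "C_move E [a, a, a] [a, a]" "C_move E [a, a] [a]"
        using C_move.intros(5)[of E "[]" a "[a]"] C_move.intros(5)[of E "[]" a "[]"] by simp_all
      with True show ?thesis by (metis r_into_equivclp equivclp_trans)
    next
      case False
      with ab have "C_move E [a, b, a] [a]" using C_move.intros(4)[of E a b "[]" "[]"] by simp
      then show ?thesis by (rule r_into_equivclp)
    qed
    from equivclp_trans[OF 1 2] show ?thesis by simp
  qed
qed

lemma adj_commute: "adj E x y \<longleftrightarrow> adj E y x"
  by (simp add: adj_def insert_commute)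

lemma based_loops_append:
  assumes "p \<in> based_loops V E v" "q \<in> based_loops V E v"
  shows "p @ tl q \<in> based_loops V E v" "p @ tl q = butlast p @ q"
proof -
  define p' q' where "p' = butlast p" and "q' = tl q"
  have p': "p = p' @ [v]"
    using assms(1) append_butlast_last_id[of p] by (simp add: based_loops_def p'_def)
  have q': "q = v # q'"
    using assms(2) list.collapse[of q] by (simp add: based_loops_def q'_def)
  show "p @ tl q = butlast p @ q" using p' q' by simp
  have "successively (\<lambda>x y. x = y \<or> adj E x y) (p @ q')"
    using assms q' unfolding successively_append_iff
    by (auto simp: based_loops_def successively_Cons)
  then show "p @ tl q \<in> based_loops V E v"
    using assms p' q' by (auto simp: based_loops_def hd_append split: if_splits)
qed

lemma based_loops_rev:
  assumes "p \<in> based_loops V E v"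
  shows "rev p \<in> based_loops V E v"
proof -
  have "(\<lambda>x y. y = x \<or> adj E y x) = (\<lambda>x y. x = y \<or> adj E x y)"
    by (intro ext) (metis adj_commute)
  then have "successively (\<lambda>x y. y = x \<or> adj E y x) p"
    using assms by (simp only: based_loops_def mem_Collect_eq)
  then show ?thesis
    using assms by (simp add: based_loops_def hd_rev last_rev)
qed

lemma equiv_C_homotopy: "equiv (based_loops V E v) (C_homotopy V E v)"
proof (rule equivI)
  show "C_homotopy V E v \<subseteq> based_loops V E v \<times> based_loops V E v"
    by (auto simp: C_homotopy_def)
  show "refl_on (based_loops V E v) (C_homotopy V E v)"
    by (auto simp: C_homotopy_def refl_on_def)
  show "sym (C_homotopy V E v)"
    unfolding C_homotopy_def by (rule symI) (simp add: equivclp_sym)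
  show "trans (C_homotopy V E v)"
    unfolding C_homotopy_def by (rule transI) (auto elim: equivclp_trans)
qed

lemma C_homotopy_append:
  assumes "(p, p') \<in> C_homotopy V E v" "(q, q') \<in> C_homotopy V E v"
  shows "(p @ tl q, p' @ tl q') \<in> C_homotopy V E v"
proof -
  have L: "p \<in> based_loops V E v" "p' \<in> based_loops V E v"
          "q \<in> based_loops V E v" "q' \<in> based_loops V E v"
    and pp: "equivclp (C_move E) p p'" and qq: "equivclp (C_move E) q q'"
    using assms by (auto simp: C_homotopy_def)
  have "equivclp (C_move E) (p @ tl q) (p' @ tl q)"
    using equivclp_C_move_context[OF pp, of "[]" "tl q"] by simp
  moreover have "equivclp (C_move E) (p' @ tl q) (p' @ tl q')"
    using equivclp_C_move_context[OF qq, of "butlast p'" "[]"]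
      based_loops_append(2)[OF L(2,3)] based_loops_append(2)[OF L(2,4)] by simp
  ultimately show ?thesis
    using based_loops_append(1)[OF L(1,3)] based_loops_append(1)[OF L(2,4)]
    by (simp add: C_homotopy_def equivclp_trans[of _ _ "p' @ tl q"])
qed

lemma C_homotopy_rev:
  assumes "p \<in> based_loops V E v"
  shows "(rev p @ tl p, [v]) \<in> C_homotopy V E v"
proof -
  have r: "rev p \<in> based_loops V E v" using assms by (rule based_loops_rev)
  have "rev p @ tl p = butlast (rev p) @ rev (rev p)"
    using based_loops_append(2)[OF r assms] by simp
  moreover have "equivclp (C_move E) (butlast (rev p) @ rev (rev p)) [hd (rev p)]"
    using r by (intro equivclp_C_move_backtrack) (auto simp: based_loops_def)
  moreover have "hd (rev p) = v" "[v] \<in> based_loops V E v"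
    using r assms last_in_set[of p] by (auto simp: based_loops_def)
  ultimately show ?thesis
    using based_loops_append(1)[OF r assms] by (simp add: C_homotopy_def)
qed

lemma group_fundamental_group:
  assumes "v \<in> V"
  shows "group (fundamental_group V E v)"
proof -
  let ?L = "based_loops V E v" and ?R = "C_homotopy V E v" and ?G = "fundamental_group V E v"
  note eq = equiv_C_homotopy[of V E v]
  have mult: "?R `` {p} \<otimes>\<^bsub>?G\<^esub> ?R `` {q} = ?R `` {p @ tl q}" if "p \<in> ?L" "q \<in> ?L" for p q
  proof -
    have "congruent2 ?R ?R (\<lambda>p q. ?R `` {p @ tl q})"
      by (intro congruent2I' equiv_class_eq[OF eq] C_homotopy_append)
    from UN_equiv_class2[OF eq eq this that] show ?thesis by (simp add: fundamental_group_def)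
  qed
  have one: "[v] \<in> ?L" using assms by (simp add: based_loops_def)
  have car: "A \<in> carrier ?G \<longleftrightarrow> (\<exists>p\<in>?L. A = ?R `` {p})" for A
    by (auto simp: fundamental_group_def quotient_def)
  have oneG: "\<one>\<^bsub>?G\<^esub> = ?R `` {[v]}" by (simp add: fundamental_group_def)
  show ?thesis
  proof (rule groupI)
    fix A B assume "A \<in> carrier ?G" "B \<in> carrier ?G"
    then show "A \<otimes>\<^bsub>?G\<^esub> B \<in> carrier ?G" using mult based_loops_append(1) by (fastforce simp: car)
  next
    show "\<one>\<^bsub>?G\<^esub> \<in> carrier ?G" using one car oneG by blast
  next
    fix A B C assume "A \<in> carrier ?G" "B \<in> carrier ?G" "C \<in> carrier ?G"
    then obtain p q r where pqr: "p \<in> ?L" "q \<in> ?L" "r \<in> ?L"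
      "A = ?R `` {p}" "B = ?R `` {q}" "C = ?R `` {r}" by (auto simp: car)
    moreover have "q \<noteq> []" using pqr(2) by (simp add: based_loops_def)
    ultimately show "A \<otimes>\<^bsub>?G\<^esub> B \<otimes>\<^bsub>?G\<^esub> C = A \<otimes>\<^bsub>?G\<^esub> (B \<otimes>\<^bsub>?G\<^esub> C)"
      by (simp add: mult based_loops_append(1))
  next
    fix A assume "A \<in> carrier ?G"
    then obtain p where p: "p \<in> ?L" "A = ?R `` {p}" by (auto simp: car)
    moreover have "[v] @ tl p = p" using p(1) by (cases p) (auto simp: based_loops_def)
    ultimately show "\<one>\<^bsub>?G\<^esub> \<otimes>\<^bsub>?G\<^esub> A = A" using mult[OF one p(1)] oneG by simp
  next
    fix A assume "A \<in> carrier ?G"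
    then obtain p where p: "p \<in> ?L" "A = ?R `` {p}" by (auto simp: car)
    have "?R `` {rev p} \<otimes>\<^bsub>?G\<^esub> A = \<one>\<^bsub>?G\<^esub>"
      using mult[OF based_loops_rev[OF p(1)] p(1)] equiv_class_eq[OF eq C_homotopy_rev[OF p(1)]]
        p(2) oneG by simp
    moreover have "?R `` {rev p} \<in> carrier ?G" using based_loops_rev[OF p(1)] car by blast
    ultimately show "\<exists>B\<in>carrier ?G. B \<otimes>\<^bsub>?G\<^esub> A = \<one>\<^bsub>?G\<^esub>" by blast
  qed
qed

end

theory Submission
  imports Defs
begin

text \<open>
  The idea is to work on the universal cover of the graph with respect to triangles and squares.
  Its vertices are the homotopy classes of walks that start at the base vertex, and the loop
  classes are the fibre over that vertex. As triangles and squares lift to the cover, a ball of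
  radius two in the cover looks like the one below it, up to edges between vertices at distance
  two from the centre, and \<open>\<Gamma>\<^sub>2\<close> at the centre does not see these edges; so the cover has the same
  curvature bound. As in the Bonnet--Myers theorem, this bounds the diameter of the cover, which
  has bounded degree and hence is finite.

  The cover is never built as a graph. A function on it is a function \<open>F\<close> of words that is constant on
  homotopy classes, and the neighbours of the class of \<open>w\<close> are the classes of the words \<open>w @ [y]\<close> with
  \<open>y\<close> adjacent to \<open>last w\<close>. The curvature inequality for such functions is \<open>lifted_curvature\<close>.

  The diameter bound replaces the heat semigroup by its explicit Euler scheme
  \<open>F \<mapsto> F + \<epsilon> \<Delta>F\<close>. If \<open>2 \<Gamma>(F) \<le> G\<close> everywhere, then the curvature inequality, together with
  \<open>\<epsilon>\<^sup>2 \<Gamma>(\<Delta>F) = O(\<epsilon>\<^sup>2 G)\<close>, yields the bound \<open>(1 - K \<epsilon>) G\<close> after one step, provided that \<open>\<epsilon>\<close> is small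
  (\<open>heat_step_contracts\<close>). So the total displacement of the values under the iteration is bounded by a geometric
  series, while the increments of the iterates tend to zero. A function with bounded increments
  is therefore itself bounded (\<open>bounded_increments_imp_bounded\<close>). Applied to the minimal length of a word in a class,
  this shows that every loop is homotopic to one of bounded length, and there are only
  finitely many of those.
\<close>


section \<open>Walks up to homotopy\<close>

lemma (in simple_graph) adjD:
  assumes "adj E x y"
  shows "x \<in> V" "y \<in> V" "x \<noteq> y"
proof -
  have "{x, y} \<subseteq> V" "card {x, y} = 2" using edges[OF assms[unfolded adj_def]] by blast+
  then show "x \<in> V" "y \<in> V" "x \<noteq> y" by auto
qed

lemma (in simple_graph) finite_neighbours:
  assumes "finite V"
  shows "finite {y. adj E x y}" "card {y. adj E x y} \<le> card V"
proof -
  have "{y. adj E x y} \<subseteq> V" using adjD by blast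
  then show "finite {y. adj E x y}" "card {y. adj E x y} \<le> card V"
    using assms by (auto intro: finite_subset card_mono)
qed

lemma C_move_last:
  assumes "C_move E p q"
  shows "last p = last q"
  using assms by cases (auto simp: last_append)

lemma equivclp_C_move_snoc:
  assumes "equivclp (C_move E) p q"
  shows "equivclp (C_move E) (p @ [y]) (q @ [y])"
  using equivclp_C_move_context[OF assms, of "[]" "[y]"] by simp

lemma based_loops_replace_middle:
  assumes "m \<noteq> []" "m' \<noteq> []" "hd m = hd m'" "last m = last m'"
    and "set m \<subseteq> V" "set m' \<subseteq> V"
    and "successively (\<lambda>x y. x = y \<or> adj E x y) m" "successively (\<lambda>x y. x = y \<or> adj E x y) m'"
  shows "us @ m @ ws \<in> based_loops V E v \<longleftrightarrow> us @ m' @ ws \<in> based_loops V E v"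
proof -
  have "hd (us @ m @ ws) = hd (us @ m' @ ws)" "last (us @ m @ ws) = last (us @ m' @ ws)"
    using assms by (simp_all add: hd_append last_append)
  moreover have "successively P (us @ m @ ws) \<longleftrightarrow> successively P (us @ m' @ ws)"
    if "P = (\<lambda>x y. x = y \<or> adj E x y)" for P
    using assms that by (simp add: successively_append_iff)
  ultimately show ?thesis
    using assms(1,2,5,6) by (simp add: based_loops_def)
qed

lemma (in simple_graph) C_move_based_loops:
  assumes "C_move E p q"
  shows "p \<in> based_loops V E v \<longleftrightarrow> q \<in> based_loops V E v"
  using assms
proof cases
  case (1 a b c us ws)
  then have "a \<in> V" "b \<in> V" "c \<in> V" "adj E a b" "adj E b c" "adj E a c"
    using adjD adj_commute[of E a c] unfolding triangle_def by blast+
  then show ?thesis unfolding 1 by (intro based_loops_replace_middle) auto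
next
  case (2 a b c d us ws)
  then have "a \<in> V" "b \<in> V" "c \<in> V" "d \<in> V" "adj E a b" "adj E b c" "adj E a d" "adj E d c"
    using adjD adj_commute[of E a d] adj_commute[of E d c] unfolding square_def by blast+
  then show ?thesis unfolding 2 by (intro based_loops_replace_middle) auto
next
  case (3 a b c d us ws)
  then have "a \<in> V" "b \<in> V" "c \<in> V" "d \<in> V" "adj E a b" "adj E b c" "adj E c d" "adj E a d"
    using adjD adj_commute[of E a d] unfolding square_def by blast+
  then show ?thesis unfolding 3 by (intro based_loops_replace_middle) auto
next
  case (4 a b us ws)
  then have "a \<in> V" "b \<in> V" "adj E a b" "adj E b a"
    using adjD adj_commute[of E a b] by blast+
  then show ?thesis unfolding 4 by (intro based_loops_replace_middle) auto
next
  case (5 us a ws)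
  have "us @ [a, a] @ ws \<in> based_loops V E v \<longleftrightarrow> us @ [a] @ ws \<in> based_loops V E v" if "a \<in> V"
    using that by (intro based_loops_replace_middle) auto
  then show ?thesis unfolding 5 by (auto simp: based_loops_def)
qed

lemma (in simple_graph) equivclp_C_move_based_loops:
  assumes "equivclp (C_move E) p q" "p \<in> based_loops V E v"
  shows "q \<in> based_loops V E v"
  using assms(1)
proof (induction rule: equivclp_induct)
  case base
  show ?case by fact
next
  case (step y z)
  then show ?case using C_move_based_loops by metis
qed


section \<open>Calculus on the universal cover\<close>

definition C_invariant :: "'a set set \<Rightarrow> ('a list \<Rightarrow> real) \<Rightarrow> bool" where
  "C_invariant E F \<longleftrightarrow> (\<forall>p q. C_move E p q \<longrightarrow> F p = F q)"

definition lift_laplacian :: "'a set set \<Rightarrow> ('a list \<Rightarrow> real) \<Rightarrow> 'a list \<Rightarrow> real" where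
  "lift_laplacian E F w = (\<Sum>y | adj E (last w) y. F (w @ [y]) - F w)"

text \<open>This is \<open>2 \<Gamma>(F)\<close> on the universal cover.\<close>

definition lift_energy :: "'a set set \<Rightarrow> ('a list \<Rightarrow> real) \<Rightarrow> 'a list \<Rightarrow> real" where
  "lift_energy E F w = (\<Sum>y | adj E (last w) y. (F (w @ [y]) - F w)\<^sup>2)"

lemma C_invariantD: "C_invariant E F \<Longrightarrow> C_move E p q \<Longrightarrow> F p = F q"
  by (simp add: C_invariant_def)

lemma C_invariant_equivclp:
  assumes "C_invariant E F" "equivclp (C_move E) p q"
  shows "F p = F q"
  using assms(2)
  by (induction rule: equivclp_induct) (auto dest: C_invariantD[OF assms(1)])

lemma C_invariant_lift_laplacian:
  assumes "C_invariant E F"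
  shows "C_invariant E (lift_laplacian E F)"
  unfolding C_invariant_def
proof (intro allI impI)
  fix p q assume pq: "C_move E p q"
  have "F (p @ [y]) = F (q @ [y])" for y
    using C_invariant_equivclp[OF assms] equivclp_C_move_snoc r_into_equivclp[of "C_move E", OF pq] by metis
  then show "lift_laplacian E F p = lift_laplacian E F q"
    using C_invariantD[OF assms pq] C_move_last[OF pq] by (simp add: lift_laplacian_def)
qed

lemma lift_energy_nonneg: "0 \<le> lift_energy E F w"
  by (simp add: lift_energy_def sum_nonneg)

lemma (in simple_graph) lift_laplacian_squared_le:
  assumes "finite V"
  shows "(lift_laplacian E F w)\<^sup>2 \<le> card V * lift_energy E F w"
proof -
  let ?N = "{y. adj E (last w) y}"
  have "(lift_laplacian E F w)\<^sup>2 \<le> card ?N * lift_energy E F w"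
    using Cauchy_Schwarz_ineq_sum[of "\<lambda>_. 1" "\<lambda>y. F (w @ [y]) - F w" ?N]
    by (simp add: lift_laplacian_def lift_energy_def)
  also have "\<dots> \<le> card V * lift_energy E F w"
    using finite_neighbours(2)[OF assms] lift_energy_nonneg by (intro mult_right_mono) auto
  finally show ?thesis .
qed

lemma (in simple_graph) increment_squared_le_lift_energy:
  assumes "finite V" "adj E (last w) y"
  shows "(F (w @ [y]) - F w)\<^sup>2 \<le> lift_energy E F w"
  unfolding lift_energy_def
  using finite_neighbours(1)[OF assms(1)] assms(2) by (intro member_le_sum) auto


section \<open>The curvature bound lifts to the cover\<close>

lemma Gamma1_eq_sum:
  "Gamma1 E f g x = (\<Sum>y | adj E x y. (f y - f x) * (g y - g x)) / 2"
  by (simp add: Gamma1_def laplacian_def sum_distrib_left algebra_simps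
      flip: sum_subtractf sum.distrib)

text \<open>
  The projection of the cover is injective on balls of radius two, so that a function on such a
  ball descends. Two walks of length two with the same ends bound a square, or one of them can be shortened
  by a triangle or a backtracking step.
\<close>

lemma (in simple_graph) descend_to_two_ball:
  assumes inv: "C_invariant E F" and "w \<noteq> []"
  obtains f where "f (last w) = F w"
    and "\<And>y. adj E (last w) y \<Longrightarrow> f y = F (w @ [y])"
    and "\<And>y z. adj E (last w) y \<Longrightarrow> adj E y z \<Longrightarrow> f z = F (w @ [y, z])"
proof -
  define x where "x = last w"
  obtain us where w: "w = us @ [x]"
    using \<open>w \<noteq> []\<close> x_def append_butlast_last_id by metis
  define f where "f z = (if z = x then F w else if adj E x z then F (w @ [z])
    else F (w @ [SOME y. adj E x y \<and> adj E y z, z]))" for z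
  have step: "f y = F (w @ [y])" if "adj E x y" for y
    using that adjD(3) by (auto simp: f_def)
  have two_steps: "f z = F (w @ [y, z])" if xy: "adj E x y" and yz: "adj E y z" for y z
  proof -
    consider "z = x" | "z \<noteq> x" "adj E x z" | "z \<noteq> x" "\<not> adj E x z" by blast
    then show ?thesis
    proof cases
      case 1
      then have "C_move E (w @ [y, z]) w"
        using C_move.intros(4)[OF xy, of us "[]"] w by simp
      then show ?thesis using 1 C_invariantD[OF inv] by (simp add: f_def)
    next
      case 2
      then have "triangle E x y z"
        using xy yz adjD(3) by (auto simp: triangle_def adj_commute)
      then have "C_move E (w @ [y, z]) (w @ [z])"
        using C_move.intros(1)[of E x y z us "[]"] w by simp
      then show ?thesis using 2 C_invariantD[OF inv] by (simp add: f_def)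
    next
      case 3
      define y' where "y' = (SOME y. adj E x y \<and> adj E y z)"
      have y': "adj E x y'" "adj E y' z"
        using someI[of "\<lambda>y. adj E x y \<and> adj E y z", OF conjI[OF xy yz]] by (auto simp: y'_def)
      have fz: "f z = F (w @ [y', z])" using 3 by (simp add: f_def y'_def)
      show ?thesis
      proof (cases "y = y'")
        case True
        then show ?thesis using fz by simp
      next
        case False
        then have "square E x y z y'"
          using xy yz y' 3 adjD(3) by (auto simp: square_def adj_commute)
        then have "C_move E (w @ [y, z]) (w @ [y', z])"
          using C_move.intros(2)[of E x y z y' us "[]"] w by simp
        then show ?thesis using fz C_invariantD[OF inv] by simp
      qed
    qed
  qed
  show ?thesis
    using that[of f] step two_steps by (simp add: f_def x_def)
qed

text \<open>
  This is \<open>\<Gamma>\<^sub>2(F) \<ge> K \<Gamma>(F)\<close> on the cover, with \<open>2 \<Gamma>(F, \<Delta>F)\<close> isolated on the left.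
\<close>

lemma (in simple_graph) lifted_curvature:
  assumes CD: "CD V E K \<infinity>" and inv: "C_invariant E F" and w: "w \<noteq> []" "last w \<in> V"
  shows "(\<Sum>y | adj E (last w) y. (F (w @ [y]) - F w) *
            (lift_laplacian E F (w @ [y]) - lift_laplacian E F w))
      \<le> (\<Sum>y | adj E (last w) y. lift_energy E F (w @ [y]) - lift_energy E F w) / 2
         - K * lift_energy E F w"
proof -
  define x where "x = last w"
  obtain f where f0: "f x = F w"
    and f1: "\<And>y. adj E x y \<Longrightarrow> f y = F (w @ [y])"
    and f2: "\<And>y z. adj E x y \<Longrightarrow> adj E y z \<Longrightarrow> f z = F (w @ [y, z])"
    using descend_to_two_ball[OF inv w(1)] unfolding x_def by blast
  have lap0: "laplacian E f x = lift_laplacian E F w"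
    unfolding laplacian_def lift_laplacian_def x_def[symmetric]
    by (rule sum.cong) (auto simp: f0 f1)
  have lap1: "laplacian E f y = lift_laplacian E F (w @ [y])" if "adj E x y" for y
    unfolding laplacian_def lift_laplacian_def
    by (rule sum.cong) (use that in \<open>auto simp: f1 f2\<close>)
  have Gam0: "Gamma1 E f f x = lift_energy E F w / 2"
    unfolding Gamma1_eq_sum lift_energy_def x_def[symmetric]
    by (rule arg_cong[where f = "\<lambda>s. s / 2"], rule sum.cong)
       (auto simp: f0 f1 power2_eq_square)
  have Gam1: "Gamma1 E f f y = lift_energy E F (w @ [y]) / 2" if "adj E x y" for y
    unfolding Gamma1_eq_sum lift_energy_def
    by (rule arg_cong[where f = "\<lambda>s. s / 2"], rule sum.cong)
       (use that in \<open>auto simp: f1 f2 power2_eq_square\<close>)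
  have mixed: "Gamma1 E f (laplacian E f) x = (\<Sum>y | adj E x y. (F (w @ [y]) - F w) *
            (lift_laplacian E F (w @ [y]) - lift_laplacian E F w)) / 2"
    unfolding Gamma1_eq_sum
    by (rule arg_cong[where f = "\<lambda>s. s / 2"], rule sum.cong) (auto simp: f0 f1 lap0 lap1)
  have "laplacian E (Gamma1 E f f) x
      = (\<Sum>y | adj E x y. (lift_energy E F (w @ [y]) - lift_energy E F w) / 2)"
    unfolding laplacian_def
    by (rule sum.cong) (auto simp: Gam0 Gam1 diff_divide_distrib)
  then have lapGam: "laplacian E (Gamma1 E f f) x
      = (\<Sum>y | adj E x y. lift_energy E F (w @ [y]) - lift_energy E F w) / 2"
    by (simp add: sum_divide_distrib)
  define S where "S = (\<Sum>y | adj E x y. (F (w @ [y]) - F w) *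
            (lift_laplacian E F (w @ [y]) - lift_laplacian E F w))"
  define T where "T = (\<Sum>y | adj E x y. lift_energy E F (w @ [y]) - lift_energy E F w)"
  have "K * Gamma1 E f f x \<le> Gamma2 E f f x"
    using CD w(2) by (simp add: CD_infinity_iff x_def)
  then have "K * lift_energy E F w / 2 \<le> (T / 2 - S / 2 - S / 2) / 2"
    by (simp only: Gamma2_def lapGam mixed Gam0 times_divide_eq_right S_def T_def)
  then have "S \<le> T / 2 - K * lift_energy E F w" by argo
  then show ?thesis by (simp only: x_def S_def T_def)
qed


section \<open>The discrete heat flow\<close>

definition heat_step :: "'a set set \<Rightarrow> real \<Rightarrow> ('a list \<Rightarrow> real) \<Rightarrow> 'a list \<Rightarrow> real" where
  "heat_step E \<epsilon> F w = F w + \<epsilon> * lift_laplacian E F w"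

lemma C_invariant_heat_step:
  assumes "C_invariant E F"
  shows "C_invariant E (heat_step E \<epsilon> F)"
  using assms C_invariant_lift_laplacian[OF assms] by (simp add: C_invariant_def heat_step_def)

text \<open>
  Expanding \<open>2 \<Gamma>(F + \<epsilon> \<Delta>F)\<close> and inserting the curvature inequality for the term of first order leaves
  a combination of the values of \<open>2 \<Gamma>(F)\<close> at the vertex and at its neighbours. The condition on
  \<open>\<epsilon>\<close> makes its coefficients nonnegative, so that the uniform bound \<open>G\<close> can be inserted. The
  term of second order is at most \<open>4 \<epsilon>\<^sup>2 (card V)\<^sup>2 G\<close>.
\<close>

lemma (in simple_graph) heat_step_energy_le:
  fixes K \<epsilon> G :: real
  assumes fin: "finite V" and CD: "CD V E K \<infinity>" and inv: "C_invariant E F"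
    and "0 \<le> \<epsilon>" and \<epsilon>: "\<epsilon> * (card V + 2 * K) \<le> 1"
    and G: "\<And>u. u \<noteq> [] \<Longrightarrow> last u \<in> V \<Longrightarrow> lift_energy E F u \<le> G"
    and w: "w \<noteq> []" "last w \<in> V"
  shows "lift_energy E (heat_step E \<epsilon> F) w \<le> (1 - 2 * K * \<epsilon> + 4 * (real (card V))\<^sup>2 * \<epsilon>\<^sup>2) * G"
proof -
  define N where "N = {y. adj E (last w) y}"
  define L where "L = lift_laplacian E F"
  define e where "e = lift_energy E F"
  define d where "d = real (card N)"
  define D where "D = real (card V)"
  have fN: "finite N" and dD: "d \<le> D"
    using finite_neighbours[OF fin] by (auto simp: N_def d_def D_def)
  have G0: "0 \<le> G" using order_trans[OF lift_energy_nonneg G[OF w]] .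
  have ew: "e w \<le> G" using G w by (simp add: e_def)
  have eN: "e (w @ [y]) \<le> G" if "y \<in> N" for y
    using that G[of "w @ [y]"] adjD by (auto simp: e_def N_def)
  have L2: "(L u)\<^sup>2 \<le> D * G" if "e u \<le> G" for u
    using lift_laplacian_squared_le[OF fin, of F u] mult_left_mono[OF that, of D]
    by (simp add: L_def e_def D_def)
  have "(L (w @ [y]) - L w)\<^sup>2 \<le> 4 * D * G" if "y \<in> N" for y
  proof -
    have "(L (w @ [y]) - L w)\<^sup>2 \<le> 2 * (L (w @ [y]))\<^sup>2 + 2 * (L w)\<^sup>2"
      using zero_le_power2[of "L (w @ [y]) + L w"] by (simp add: power2_eq_square algebra_simps)
    then show ?thesis using L2[OF ew] L2[OF eN[OF that]] by linarith
  qed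
  then have "(\<Sum>y\<in>N. (L (w @ [y]) - L w)\<^sup>2) \<le> d * (4 * D * G)"
    using sum_bounded_above[of N "\<lambda>y. (L (w @ [y]) - L w)\<^sup>2"] by (simp add: d_def)
  also have "\<dots> \<le> D * (4 * D * G)"
    using dD G0 by (intro mult_right_mono) (auto simp: D_def)
  finally have second: "(\<Sum>y\<in>N. (L (w @ [y]) - L w)\<^sup>2) \<le> 4 * D\<^sup>2 * G"
    by (simp add: power2_eq_square algebra_simps)
  have "(\<Sum>y\<in>N. e (w @ [y])) \<le> d * G"
    using sum_bounded_above[of N "\<lambda>y. e (w @ [y])"] eN by (simp add: d_def)
  then have "(\<Sum>y\<in>N. e (w @ [y]) - e w) \<le> d * G - d * e w"
    by (simp add: sum_subtractf d_def)
  then have first: "2 * (\<Sum>y\<in>N. (F (w @ [y]) - F w) * (L (w @ [y]) - L w))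
      \<le> d * G - d * e w - 2 * K * e w"
    using lifted_curvature[OF CD inv w] by (simp add: N_def L_def e_def)
  have "lift_energy E (heat_step E \<epsilon> F) w
      = (\<Sum>y\<in>N. (F (w @ [y]) - F w)\<^sup>2
          + (\<epsilon> * (2 * ((F (w @ [y]) - F w) * (L (w @ [y]) - L w)))
          + \<epsilon>\<^sup>2 * (L (w @ [y]) - L w)\<^sup>2))"
    unfolding lift_energy_def heat_step_def N_def[symmetric] L_def[symmetric]
    by (rule sum.cong) (auto simp: power2_eq_square algebra_simps)
  also have "\<dots> = e w + (\<epsilon> * (2 * (\<Sum>y\<in>N. (F (w @ [y]) - F w) * (L (w @ [y]) - L w)))
      + \<epsilon>\<^sup>2 * (\<Sum>y\<in>N. (L (w @ [y]) - L w)\<^sup>2))"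
    by (simp add: sum.distrib sum_distrib_left e_def lift_energy_def N_def)
  also have "\<dots> \<le> e w + (\<epsilon> * (d * G - d * e w - 2 * K * e w) + \<epsilon>\<^sup>2 * (4 * D\<^sup>2 * G))"
    using first second \<open>0 \<le> \<epsilon>\<close> by (intro add_mono mult_left_mono) auto
  also have "\<dots> = (1 - \<epsilon> * (d + 2 * K)) * e w + \<epsilon> * d * G + 4 * D\<^sup>2 * \<epsilon>\<^sup>2 * G"
    by (simp add: algebra_simps)
  also have "\<dots> \<le> (1 - \<epsilon> * (d + 2 * K)) * G + \<epsilon> * d * G + 4 * D\<^sup>2 * \<epsilon>\<^sup>2 * G"
  proof -
    have "\<epsilon> * (d + 2 * K) \<le> \<epsilon> * (D + 2 * K)" using dD \<open>0 \<le> \<epsilon>\<close> by (intro mult_left_mono) auto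
    then have "0 \<le> 1 - \<epsilon> * (d + 2 * K)" using \<epsilon> by (simp add: D_def)
    then show ?thesis using ew by (simp add: mult_left_mono)
  qed
  also have "\<dots> = (1 - 2 * K * \<epsilon> + 4 * D\<^sup>2 * \<epsilon>\<^sup>2) * G"
    by (simp add: algebra_simps)
  finally show ?thesis by (simp add: D_def)
qed

text \<open>
  The loss \<open>2 K \<epsilon>\<close> is linear in \<open>\<epsilon>\<close> and the error is quadratic, so a small step size makes the
  energy decay by a fixed factor.
\<close>

lemma (in simple_graph) heat_step_contracts:
  assumes fin: "finite V" and "K > 0" and CD: "CD V E K \<infinity>"
  obtains \<epsilon> q :: real where "0 \<le> \<epsilon>" "0 \<le> q" "q < 1"
    and "\<And>F G w. C_invariant E F \<Longrightarrow>
          (\<And>u. u \<noteq> [] \<Longrightarrow> last u \<in> V \<Longrightarrow> lift_energy E F u \<le> G) \<Longrightarrow>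
          w \<noteq> [] \<Longrightarrow> last w \<in> V \<Longrightarrow> lift_energy E (heat_step E \<epsilon> F) w \<le> q * G"
proof
  define D where "D = real (card V)"
  (* The first two summands of S keep the coefficients of the energies nonnegative; the last one
     makes the error of second order at most half of the gain of first order. *)
  define S where "S = D + 2 * K + 4 * D\<^sup>2 / K"
  define \<epsilon> where "\<epsilon> = 1 / S"
  have D0: "0 \<le> D" by (simp add: D_def)
  have "0 \<le> 4 * D\<^sup>2 / K" using \<open>K > 0\<close> by simp
  with D0 have S: "0 < S" "D + 2 * K \<le> S" "4 * D\<^sup>2 / K \<le> S"
    using \<open>K > 0\<close> unfolding S_def by linarith+
  show \<epsilon>0: "0 \<le> \<epsilon>" using S by (simp add: \<epsilon>_def)
  have a: "\<epsilon> * (D + 2 * K) \<le> 1" using S by (simp add: \<epsilon>_def)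
  have b: "4 * D\<^sup>2 * \<epsilon> \<le> K"
    using S(1,3) \<open>K > 0\<close> by (simp add: \<epsilon>_def field_simps)
  have "K * \<epsilon> \<le> \<epsilon> * (D + 2 * K)"
    using D0 \<open>K > 0\<close> \<epsilon>0 by (simp add: algebra_simps)
  then show "0 \<le> 1 - K * \<epsilon>" using a by simp
  show "1 - K * \<epsilon> < 1" using S \<open>K > 0\<close> by (simp add: \<epsilon>_def)
  fix F w and G :: real
  assume inv: "C_invariant E F" and w: "w \<noteq> []" "last w \<in> V"
    and G: "\<And>u. u \<noteq> [] \<Longrightarrow> last u \<in> V \<Longrightarrow> lift_energy E F u \<le> G"
  have G0: "0 \<le> G" using order_trans[OF lift_energy_nonneg G[OF w]] .
  have "lift_energy E (heat_step E \<epsilon> F) w \<le> (1 - 2 * K * \<epsilon> + 4 * D\<^sup>2 * \<epsilon>\<^sup>2) * G"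
    unfolding D_def
    by (rule heat_step_energy_le[OF fin CD inv \<epsilon>0 _ G w]) (use a in \<open>simp_all add: D_def\<close>)
  also have "\<dots> \<le> (1 - K * \<epsilon>) * G"
    using mult_right_mono[OF b \<epsilon>0] G0
    by (intro mult_right_mono) (auto simp: power2_eq_square mult.assoc)
  finally show "lift_energy E (heat_step E \<epsilon> F) w \<le> (1 - K * \<epsilon>) * G" .
qed

text \<open>
  Since \<open>\<Gamma>\<close> decays geometrically under the flow, so does \<open>\<Delta>\<close> by the Cauchy--Schwarz inequality.
  Hence the flow moves the values of \<open>F\<close> by at most the sum \<open>C\<close> of a geometric series, and far along
  the flow the difference of the values at the ends of any fixed walk becomes arbitrarily small.
  Altogether the values of \<open>F\<close> at the ends of a walk differ by at most \<open>2 C\<close>.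
\<close>

lemma (in simple_graph) bounded_increments_imp_bounded:
  assumes fin: "finite V" and "K > 0" and CD: "CD V E K \<infinity>" and inv: "C_invariant E F"
    and incr: "\<And>w y. w \<noteq> [] \<Longrightarrow> adj E (last w) y \<Longrightarrow> \<bar>F (w @ [y]) - F w\<bar> \<le> 1"
  obtains B where "\<And>w. w \<noteq> [] \<Longrightarrow> set w \<subseteq> V \<Longrightarrow> successively (\<lambda>x y. x = y \<or> adj E x y) w \<Longrightarrow>
    \<bar>F w - F [hd w]\<bar> \<le> B"
proof -
  obtain \<epsilon> q :: real where \<epsilon>: "0 \<le> \<epsilon>" and q: "0 \<le> q" "q < 1"
    and contract: "\<And>F G w. C_invariant E F \<Longrightarrow>
          (\<And>u. u \<noteq> [] \<Longrightarrow> last u \<in> V \<Longrightarrow> lift_energy E F u \<le> G) \<Longrightarrow>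
          w \<noteq> [] \<Longrightarrow> last w \<in> V \<Longrightarrow> lift_energy E (heat_step E \<epsilon> F) w \<le> q * G"
    using heat_step_contracts[OF fin \<open>K > 0\<close> CD] by metis
  define H where "H n = (heat_step E \<epsilon> ^^ n) F" for n
  define D where "D = real (card V)"
  define r where "r = sqrt q"
  define C where "C = \<epsilon> * D / (1 - r)"
  have D: "0 \<le> D" and r: "0 \<le> r" "r < 1"
    using q by (simp_all add: D_def r_def)
  have H_0: "H 0 = F" and H_Suc: "H (Suc n) w = H n w + \<epsilon> * lift_laplacian E (H n) w" for n w
    by (simp_all add: H_def heat_step_def)
  have H_inv: "C_invariant E (H n)" for n
    by (induction n) (simp_all add: H_def inv C_invariant_heat_step)
  have energy: "lift_energy E (H n) w \<le> q ^ n * D" if "w \<noteq> []" "last w \<in> V" for n w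
    using that
  proof (induction n arbitrary: w)
    case 0
    have "lift_energy E F w \<le> (\<Sum>y | adj E (last w) y. 1)"
      unfolding lift_energy_def
      by (rule sum_mono) (use 0 incr in \<open>auto simp: abs_square_le_1\<close>)
    also have "\<dots> \<le> D" using finite_neighbours(2)[OF fin] by (simp add: D_def)
    finally show ?case by (simp add: H_0)
  next
    case (Suc n)
    show ?case
      using contract[OF H_inv[of n] Suc.IH Suc.prems] by (simp add: H_def mult.assoc)
  qed
  have sqrt_energy: "sqrt (q ^ n * D) = r ^ n * sqrt D" for n
    by (simp add: r_def real_sqrt_mult real_sqrt_power)
  have edge: "\<bar>H n (w @ [y]) - H n w\<bar> \<le> r ^ n * sqrt D"
    if "w \<noteq> []" "last w \<in> V" "adj E (last w) y" for n w y
  proof -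
    have "(H n (w @ [y]) - H n w)\<^sup>2 \<le> q ^ n * D"
      using increment_squared_le_lift_energy[OF fin that(3)] energy[OF that(1,2)]
      by (rule order_trans)
    then show ?thesis using real_sqrt_le_mono by (fastforce simp: sqrt_energy)
  qed
  have displacement: "\<bar>H n w - F w\<bar> \<le> C" if w: "w \<noteq> []" "last w \<in> V" for n w
  proof -
    have "\<bar>H n w - F w\<bar> \<le> \<epsilon> * D * (\<Sum>i<n. r ^ i)"
    proof (induction n)
      case 0
      show ?case by (simp add: H_0)
    next
      case (Suc n)
      have "(lift_laplacian E (H n) w)\<^sup>2 \<le> D * (q ^ n * D)"
        using lift_laplacian_squared_le[OF fin, of "H n" w]
          mult_left_mono[OF energy[OF w, of n], of D] D
        by (simp add: D_def)
      then have "\<bar>lift_laplacian E (H n) w\<bar> \<le> sqrt D * (r ^ n * sqrt D)"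
        using real_sqrt_le_mono by (fastforce simp: real_sqrt_mult[of D] sqrt_energy)
      also have "\<dots> = D * r ^ n" using D by simp
      finally have "\<bar>H (Suc n) w - H n w\<bar> \<le> \<epsilon> * (D * r ^ n)"
        using \<epsilon> by (simp add: H_Suc abs_mult mult_left_mono)
      with Suc.IH show ?case by (simp add: algebra_simps)
    qed
    also have "\<dots> \<le> \<epsilon> * D * (1 / (1 - r))"
      using r D \<epsilon> by (intro mult_left_mono) (auto simp: sum_gp_strict divide_right_mono)
    finally show ?thesis by (simp add: C_def)
  qed
  have along: "\<bar>H n w - H n [hd w]\<bar> \<le> length w * (r ^ n * sqrt D)"
    if "w \<noteq> []" "set w \<subseteq> V" "successively (\<lambda>x y. x = y \<or> adj E x y) w" for n w
    using that
  proof (induction w rule: rev_induct)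
    case Nil
    then show ?case by simp
  next
    case (snoc y w)
    show ?case
    proof (cases "w = []")
      case True
      then show ?thesis using r D by simp
    next
      case False
      then have IH: "\<bar>H n w - H n [hd w]\<bar> \<le> length w * (r ^ n * sqrt D)"
        and step: "last w = y \<or> adj E (last w) y" and lw: "last w \<in> V"
        using snoc last_in_set[OF False] by (auto simp: successively_append_iff)
      have "\<bar>H n (w @ [y]) - H n w\<bar> \<le> r ^ n * sqrt D"
        using step
      proof
        assume "last w = y"
        then obtain us where "w = us @ [y]" using False append_butlast_last_id by metis
        then have "C_move E (w @ [y]) w" using C_move.intros(5)[of E us y "[]"] by simp
        then show ?thesis using C_invariantD[OF H_inv] r D by simp
      qed (rule edge[OF False lw])
      with IH False show ?thesis by (simp add: algebra_simps)
    qed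
  qed
  have "\<bar>F w - F [hd w]\<bar> \<le> 2 * C"
    if w: "w \<noteq> []" "set w \<subseteq> V" "successively (\<lambda>x y. x = y \<or> adj E x y) w" for w
  proof -
    have "last w \<in> V" "hd w \<in> V" using w by auto
    then have "\<bar>F w - F [hd w]\<bar> \<le> 2 * C + length w * (r ^ n * sqrt D)" for n
      using displacement[of w n] displacement[of "[hd w]" n] along[OF w, of n] w(1) by simp
    moreover have "(\<lambda>n. 2 * C + length w * (r ^ n * sqrt D)) \<longlonglongrightarrow> 2 * C + length w * (0 * sqrt D)"
      using r by (intro tendsto_intros LIMSEQ_realpow_zero)
    ultimately show ?thesis
      using LIMSEQ_le_const by fastforce
  qed
  then show ?thesis by (rule that)
qed


section \<open>Minimal length in a homotopy class\<close>

definition homotopy_length :: "'a set set \<Rightarrow> 'a list \<Rightarrow> nat" where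
  "homotopy_length E w = (LEAST n. \<exists>q. equivclp (C_move E) w q \<and> length q = n)"

lemma homotopy_length_attained: "\<exists>q. equivclp (C_move E) w q \<and> length q = homotopy_length E w"
  unfolding homotopy_length_def by (rule LeastI[of _ "length w"]) (rule exI[of _ w], simp)

lemma homotopy_length_le: "equivclp (C_move E) w q \<Longrightarrow> homotopy_length E w \<le> length q"
  unfolding homotopy_length_def by (rule Least_le) auto

lemma homotopy_length_cong:
  assumes "equivclp (C_move E) p q"
  shows "homotopy_length E p = homotopy_length E q"
proof -
  have "equivclp (C_move E) p r \<longleftrightarrow> equivclp (C_move E) q r" for r
    using assms by (metis equivclp_sym equivclp_trans)
  then show ?thesis by (simp add: homotopy_length_def)
qed

lemma homotopy_length_snoc: "homotopy_length E (w @ [y]) \<le> homotopy_length E w + 1"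
proof -
  obtain q where q: "equivclp (C_move E) w q" "length q = homotopy_length E w"
    using homotopy_length_attained by blast
  then show ?thesis using homotopy_length_le[OF equivclp_C_move_snoc[OF q(1)]] by simp
qed

text \<open>
  Walking back along the new edge undoes the step, so the length also drops by at most one.
\<close>

lemma homotopy_length_snoc_ge:
  assumes "w \<noteq> []" "adj E (last w) y"
  shows "homotopy_length E w \<le> homotopy_length E (w @ [y]) + 1"
proof -
  have "C_move E (butlast w @ [last w, y, last w] @ []) (butlast w @ [last w] @ [])"
    using assms(2) by (rule C_move.intros(4))
  moreover have "butlast w @ [last w, y, last w] @ [] = (w @ [y]) @ [last w]"
    and "butlast w @ [last w] @ [] = w"
    using append_butlast_last_id[OF assms(1)]
    by (metis append.assoc append_Cons append_Nil append_Nil2)+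
  ultimately have "C_move E ((w @ [y]) @ [last w]) w" by (simp only:)
  then have "homotopy_length E w = homotopy_length E ((w @ [y]) @ [last w])"
    using homotopy_length_cong by (metis r_into_equivclp)
  then show ?thesis using homotopy_length_snoc[of E "w @ [y]" "last w"] by simp
qed

theorem theorem1p2:
  fixes V :: "'a set" and E :: "'a set set" and K :: real and v :: 'a
  assumes "simple_graph V E"
    and "finite V"
    and "K > 0"
    and "CD V E K \<infinity>"
    and "v \<in> V"
  shows "finite (carrier (fundamental_group V E v))"
proof -
  interpret simple_graph V E by fact
  let ?F = "\<lambda>w. real (homotopy_length E w)"
  have "C_invariant E ?F"
    unfolding C_invariant_def using homotopy_length_cong r_into_equivclp by metis
  moreover have "\<bar>?F (w @ [y]) - ?F w\<bar> \<le> 1" if "w \<noteq> []" "adj E (last w) y" for w y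
    using homotopy_length_snoc[of E w y] homotopy_length_snoc_ge[OF that] by linarith
  ultimately obtain B where B: "\<And>w. w \<noteq> [] \<Longrightarrow> set w \<subseteq> V \<Longrightarrow>
      successively (\<lambda>x y. x = y \<or> adj E x y) w \<Longrightarrow> \<bar>?F w - ?F [hd w]\<bar> \<le> B"
    using bounded_increments_imp_bounded[OF assms(2-4), of ?F] by blast
  define N where "N = nat \<lceil>1 + B\<rceil>"
  define short where "short = {q. set q \<subseteq> V \<and> length q \<le> N}"
  have "finite short"
    unfolding short_def by (rule finite_lists_length_le[OF \<open>finite V\<close>])
  moreover have "carrier (fundamental_group V E v) \<subseteq> (\<lambda>q. C_homotopy V E v `` {q}) ` short"
  proof
    fix A assume "A \<in> carrier (fundamental_group V E v)"
    then obtain p where p: "p \<in> based_loops V E v" and A: "A = C_homotopy V E v `` {p}"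
      by (auto simp: fundamental_group_def quotient_def)
    obtain q where pq: "equivclp (C_move E) p q" and len: "length q = homotopy_length E p"
      using homotopy_length_attained by blast
    have q: "q \<in> based_loops V E v" using pq p by (rule equivclp_C_move_based_loops)
    have "?F [v] \<le> 1" using homotopy_length_le[of E "[v]" "[v]"] by simp
    moreover have "\<bar>?F p - ?F [v]\<bar> \<le> B"
      using B[of p] p by (simp add: based_loops_def)
    ultimately have "?F p \<le> 1 + B" by linarith
    then have "length q \<le> N" unfolding len N_def by linarith
    then have "q \<in> short" using q by (simp add: short_def based_loops_def)
    moreover have "A = C_homotopy V E v `` {q}"
      unfolding A using p q pq
      by (intro equiv_class_eq[OF equiv_C_homotopy]) (simp add: C_homotopy_def)
    ultimately show "A \<in> (\<lambda>q. C_homotopy V E v `` {q}) ` short" by blast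
  qed
  ultimately show ?thesis by (meson finite_imageI finite_subset)
qed

end
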